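(* Let $f:K_{4}\to\mathbb{R}^{2}$ be a plane generic immersion of the complete graph $K_4$ on $4$ vertices. Then \[ \sum_{\gamma\in\Gamma(K_{4})}c(f(\gamma))\equiv 0\pmod 2, \] where $\Gamma(K_4)$ is the set of all cycles of $K_4$.
   Context: A finite graph $G$ is regarded as a topological space in the usual way. A cycle of $G$ is a subgraph homeomorphic to a circle (cycles are unoriented subgraphs). A plane generic immersion of $G$ is an immersion $f:G\to\mathbb{R}^2$ (a continuous locally injective, piecewise smooth map) whose multiple points are only finitely many transversal double points between edges, i.e. between interior points of edges (possibly of the same edge); these double points are called crossings. For a subgraph $H$ of $G$, $c(f(H))$ denotes the number of crossings of the restriction $f|_H$. *)

theory Defs
  imports "HOL-Analysis.Analysis" "HOL-Number_Theory.Cong"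
begin

text \<open>A finite simple graph is a pair of a vertex set and a set of two-element edges.\<close>

type_synonym 'v sgraph = "'v set \<times> 'v set set"

definition complete_graph :: "'v set \<Rightarrow> 'v sgraph" where
  "complete_graph V = (V, {e. e \<subseteq> V \<and> card e = 2})"

definition subgraph :: "'v sgraph \<Rightarrow> 'v sgraph \<Rightarrow> bool" where
  "subgraph H G \<longleftrightarrow> fst H \<subseteq> fst G \<and> snd H \<subseteq> snd G \<and> (\<forall>e\<in>snd H. e \<subseteq> fst H)"

text \<open>The topological space of a graph is its geometric realization: the vertices are unit
  vectors of \<open>\<real>\<^sup>V\<close> and an edge is the segment joining its endpoints.\<close>

definition vertex_point :: "'v::finite \<Rightarrow> real ^ 'v" where
  "vertex_point v = axis v 1"

definition realization :: "'v::finite sgraph \<Rightarrow> (real ^ 'v) set" where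
  "realization G = vertex_point ` fst G \<union> (\<Union>e\<in>snd G. convex hull (vertex_point ` e))"

definition edge_point :: "'v::finite \<Rightarrow> 'v \<Rightarrow> real \<Rightarrow> real ^ 'v" where
  "edge_point u v t = (1 - t) *\<^sub>R vertex_point u + t *\<^sub>R vertex_point v"

text \<open>The cycles are subgraphs, so each one is counted once, without orientation or base point.\<close>

definition cycles :: "'v::finite sgraph \<Rightarrow> 'v sgraph set" where
  "cycles G = {H. subgraph H G \<and> realization H homeomorphic sphere (0 :: real ^ 2) 1}"

text \<open>Smoothness is \<open>C\<^sup>\<infinity>\<close>, with one-sided derivatives at the ends of the interval; \<open>D k\<close>
  is the \<open>k\<close>-th derivative.\<close>

definition smooth_on_interval :: "real \<Rightarrow> real \<Rightarrow> (real \<Rightarrow> real ^ 2) \<Rightarrow> bool" where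
  "smooth_on_interval a b g \<longleftrightarrow>
     (\<exists>D :: nat \<Rightarrow> real \<Rightarrow> real ^ 2. (\<forall>t\<in>{a..b}. D 0 t = g t) \<and>
        (\<forall>k. \<forall>t\<in>{a..b}. (D k has_vector_derivative D (Suc k) t) (at t within {a..b})))"

text \<open>\<open>S\<close> is the set of subdivision points; \<open>a\<close> and \<open>b\<close> range over consecutive ones.\<close>

definition piecewise_smooth_path :: "(real \<Rightarrow> real ^ 2) \<Rightarrow> bool" where
  "piecewise_smooth_path g \<longleftrightarrow>
     (\<exists>S. finite S \<and> {0, 1} \<subseteq> S \<and> S \<subseteq> {0..1} \<and>
        (\<forall>a\<in>S. \<forall>b\<in>S. a < b \<and> {a<..<b} \<inter> S = {} \<longrightarrow> smooth_on_interval a b g))"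

definition graph_immersion :: "'v::finite sgraph \<Rightarrow> (real ^ 'v \<Rightarrow> real ^ 2) \<Rightarrow> bool" where
  "graph_immersion G f \<longleftrightarrow>
     continuous_on (realization G) f \<and>
     (\<forall>x\<in>realization G. \<exists>U. open U \<and> x \<in> U \<and> inj_on f (realization G \<inter> U)) \<and>
     (\<forall>u v. {u, v} \<in> snd G \<longrightarrow> piecewise_smooth_path (f \<circ> edge_point u v))"

definition multiple_points :: "('a \<Rightarrow> 'b) \<Rightarrow> 'a set \<Rightarrow> 'b set" where
  "multiple_points f X = {p. \<exists>x\<in>X. \<exists>y\<in>X. x \<noteq> y \<and> f x = p \<and> f y = p}"

text \<open>The point \<open>p\<close> has exactly two preimages, both interior to edges (possibly to the same
  edge), and the tangent lines of the two branches through \<open>p\<close> exist and span the plane.\<close>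

definition transversal_double_point ::
    "'v::finite sgraph \<Rightarrow> (real ^ 'v \<Rightarrow> real ^ 2) \<Rightarrow> real ^ 2 \<Rightarrow> bool" where
  "transversal_double_point G f p \<longleftrightarrow>
     (\<exists>u v u' v' s t a b.
        {u, v} \<in> snd G \<and> {u', v'} \<in> snd G \<and> s \<in> {0<..<1} \<and> t \<in> {0<..<1} \<and>
        edge_point u v s \<noteq> edge_point u' v' t \<and>
        {x \<in> realization G. f x = p} = {edge_point u v s, edge_point u' v' t} \<and>
        ((f \<circ> edge_point u v) has_vector_derivative a) (at s) \<and>
        ((f \<circ> edge_point u' v') has_vector_derivative b) (at t) \<and>
        span {a, b} = UNIV)"

definition plane_generic_immersion ::
    "'v::finite sgraph \<Rightarrow> (real ^ 'v \<Rightarrow> real ^ 2) \<Rightarrow> bool" where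
  "plane_generic_immersion G f \<longleftrightarrow>
     graph_immersion G f \<and>
     finite (multiple_points f (realization G)) \<and>
     (\<forall>p\<in>multiple_points f (realization G). transversal_double_point G f p)"

text \<open>The number \<open>c(f(H))\<close> of crossings of the restriction of \<open>f\<close> to \<open>H\<close>: for a generic
  immersion, the crossings are exactly the multiple points.\<close>

definition crossing_number_on :: "(real ^ 'v \<Rightarrow> real ^ 2) \<Rightarrow> 'v::finite sgraph \<Rightarrow> nat" where
  "crossing_number_on f H = card (multiple_points f (realization H))"

end

theory Submission
  imports Defs
begin

text \<open>A crossing is counted by exactly those cycles that contain the (one or two) edges carrying its
  preimages. Among the seven cycles of \<open>K\<^sub>4\<close>, an edge lies on two triangles and two quadrilaterals,
  two adjacent edges lie together on one triangle and one quadrilateral, and two opposite edges on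
  two quadrilaterals. So every crossing is counted an even number of times.

  Cycles being defined topologically, one needs that the vertices of a circle have degree two:
  an isolated vertex or a pendant edge would make a once punctured circle disconnected, and three
  edges at a vertex would give an embedding of a tripod into the line.\<close>

section \<open>Coordinates on the realization of a simple graph\<close>

text \<open>The type \<open>sgraph\<close> restricts neither the size of an edge nor where its
  endpoints lie. This predicate records what every cycle of a complete graph satisfies.\<close>

definition simple_graph :: "'v sgraph \<Rightarrow> bool" where
  "simple_graph H \<longleftrightarrow> (\<forall>e\<in>snd H. e \<subseteq> fst H \<and> card e = 2)"

lemma simple_graphD:
  assumes "simple_graph H" "{u, v} \<in> snd H"
  shows "u \<noteq> v" "u \<in> fst H" "v \<in> fst H"
  using assms unfolding simple_graph_def by force+

lemma simple_graph_if_cycle_complete: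
  assumes "H \<in> cycles (complete_graph V)"
  shows "simple_graph H" "fst H \<subseteq> V"
  using assms by (auto simp: cycles_def subgraph_def complete_graph_def simple_graph_def)

lemma edge_point_component:
  "edge_point u v t $ w = (if w = u then 1 - t else 0) + (if w = v then t else 0)"
  by (simp add: edge_point_def vertex_point_def axis_def)

lemma vertex_point_component: "vertex_point v $ w = (if w = v then 1 else 0)"
  by (simp add: vertex_point_def axis_def)

lemma vertex_point_eq_iff [simp]: "vertex_point u = vertex_point v \<longleftrightarrow> u = v"
  by (simp add: vertex_point_def axis_eq_axis)

lemma edge_point_commute: "edge_point u v t = edge_point v u (1 - t)"
  by (simp add: edge_point_def)

lemma edge_point_ends [simp]:
  "edge_point u v 0 = vertex_point u" "edge_point u v 1 = vertex_point v"
  by (simp_all add: edge_point_def)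

lemma convex_hull_edge:
  "convex hull (vertex_point ` {u, v}) = closed_segment (vertex_point u) (vertex_point v)"
  by (simp add: segment_convex_hull)

lemma convex_hull_edge_points:
  "convex hull (vertex_point ` {u, v}) = edge_point u v ` {0..1}"
  unfolding convex_hull_edge by (auto simp: closed_segment_def edge_point_def)

text \<open>Vertex points are standard basis vectors, hence affinely independent, and two faces of a
  simplex meet in the face on their common vertices. This gives the disjointness needed to build
  simple polygons from edges.\<close>

lemma convex_hull_vertex_points_Int:
  fixes e e' :: "'v::finite set"
  shows "convex hull (vertex_point ` e) \<inter> convex hull (vertex_point ` e')
    = convex hull (vertex_point ` (e \<inter> e'))"
proof -
  have "vertex_point ` e \<union> vertex_point ` e' \<subseteq> (Basis :: (real ^ 'v) set)"
    by (auto simp: vertex_point_def)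
  then have "independent (vertex_point ` e \<union> vertex_point ` e')"
    using independent_Basis independent_mono by blast
  then have "\<not> affine_dependent (vertex_point ` e \<union> vertex_point ` e')"
    using affine_dependent_imp_dependent by blast
  then show ?thesis
    by (subst convex_hull_Int [symmetric]) (auto simp: image_Int inj_on_def)
qed

lemma edge_point_in_realization:
  assumes "{u, v} \<in> snd H" "0 \<le> t" "t \<le> 1"
  shows "edge_point u v t \<in> realization H"
proof -
  have "edge_point u v t \<in> convex hull (vertex_point ` {u, v})"
    unfolding convex_hull_edge_points using assms by auto
  then show ?thesis
    using assms(1) unfolding realization_def by blast
qed

lemma vertex_point_in_realization: "v \<in> fst H \<Longrightarrow> vertex_point v \<in> realization H"
  by (simp add: realization_def)

text \<open>Endpoints of edges are absorbed into the first case, so that the parameter in the second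
  case is strictly between 0 and 1.\<close>

lemma realization_cases:
  assumes "simple_graph H" "x \<in> realization H"
  obtains (vertex) v where "v \<in> fst H" "x = vertex_point v"
  | (edge) u v t where "{u, v} \<in> snd H" "0 < t" "t < 1" "x = edge_point u v t"
proof -
  consider v where "v \<in> fst H" "x = vertex_point v"
    | e where "e \<in> snd H" "x \<in> convex hull (vertex_point ` e)"
    using assms(2) unfolding realization_def by blast
  then show thesis
  proof cases
    case 1
    then show ?thesis by (rule vertex)
  next
    case 2
    then obtain u v where e: "e = {u, v}"
      using assms(1) unfolding simple_graph_def by (meson card_2_iff)
    then obtain t where t: "0 \<le> t" "t \<le> 1" "x = edge_point u v t"
      using 2 unfolding e convex_hull_edge_points by auto
    show ?thesis
    proof (cases "t = 0 \<or> t = 1")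
      case True
      then show ?thesis
        using t vertex simple_graphD[OF assms(1), of u v] 2(1) e by auto
    next
      case False
      then show ?thesis
        using t 2(1) e by (intro edge[of u v t]) auto
    qed
  qed
qed

text \<open>The entry at \<open>v\<close> is a barycentric coordinate, nonzero only at
  \<open>v\<close> and on the edges at \<open>v\<close>. Orienting such an edge towards
  \<open>v\<close> makes this coordinate the edge parameter.\<close>

lemma realization_component_cases:
  assumes "simple_graph H" "x \<in> realization H" "x $ v \<noteq> 0" "x \<noteq> vertex_point v"
  obtains w where "{v, w} \<in> snd H" "x = edge_point w v (x $ v)"
  using assms(1,2)
proof (cases rule: realization_cases)
  case (vertex u)
  then show ?thesis
    using assms by (auto simp: vertex_point_component split: if_splits)
next
  case (edge a b t)
  have "a \<noteq> b"
    using simple_graphD(1)[OF assms(1) edge(1)] .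
  have "v = a \<or> v = b"
  proof (rule ccontr)
    assume "\<not> ?thesis"
    then have "edge_point a b t $ v = 0"
      by (simp add: edge_point_component)
    then show False
      using assms(3) unfolding edge(4) by contradiction
  qed
  then show ?thesis
  proof
    assume v: "v = a"
    have "edge_point a b t $ a = 1 - t"
      using \<open>a \<noteq> b\<close> by (simp add: edge_point_component)
    then have "x = edge_point b v (x $ v)"
      unfolding v edge(4) by (simp add: edge_point_commute[of b a])
    with edge(1) show ?thesis
      using that[of b] unfolding v by iprover
  next
    assume v: "v = b"
    have "edge_point a b t $ b = t"
      using \<open>a \<noteq> b\<close> by (simp add: edge_point_component)
    then have "x = edge_point a v (x $ v)"
      unfolding v edge(4) by simp
    moreover have "{b, a} \<in> snd H"
      using edge(1) by (simp add: insert_commute)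
    ultimately show ?thesis
      using that[of a] unfolding v by iprover
  qed
qed

text \<open>The nonzero coordinates of an interior point are those at the two ends of its edge, so
  the point lies on no other edge. Membership in a subgraph thus becomes combinatorial.\<close>

lemma edge_interior_in_realization_iff:
  assumes "simple_graph H" "u \<noteq> v" "0 < t" "t < 1"
  shows "edge_point u v t \<in> realization H \<longleftrightarrow> {u, v} \<in> snd H"
proof
  assume x: "edge_point u v t \<in> realization H"
  have c: "edge_point u v t $ v = t" "edge_point u v t $ u = 1 - t"
    using assms(2) by (auto simp: edge_point_component)
  then have "edge_point u v t \<noteq> vertex_point v"
    using assms by (metis less_irrefl vertex_point_component)
  then obtain w where w: "{v, w} \<in> snd H" "edge_point u v t = edge_point w v t"
    using realization_component_cases[OF assms(1) x, of v] c assms by auto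
  from w(2) have "edge_point w v t $ u = 1 - t"
    using c by simp
  then have "w = u"
    using assms by (auto simp: edge_point_component split: if_splits)
  then show "{u, v} \<in> snd H"
    using w by (simp add: insert_commute)
qed (use assms in \<open>simp add: edge_point_in_realization\<close>)

section \<open>Vertices on a circle have degree two\<close>

text \<open>By the intermediate value theorem both functions attain the smaller of the two end
  values. It exceeds the common initial value, so neither attains it at 0.\<close>

lemma no_two_rising_branches:
  fixes g h :: "real \<Rightarrow> real"
  assumes "0 < r" "continuous_on {0..r} g" "continuous_on {0..r} h" "g 0 = h 0"
    and "g 0 < g r" "h 0 < h r"
  shows "\<exists>s\<in>{0<..r}. \<exists>t\<in>{0<..r}. g s = h t"
proof -
  let ?m = "min (g r) (h r)"
  obtain s where s: "0 \<le> s" "s \<le> r" "g s = ?m"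
    using IVT'[of g 0 ?m r] assms by auto
  obtain t where t: "0 \<le> t" "t \<le> r" "h t = ?m"
    using IVT'[of h 0 ?m r] assms by auto
  have "s \<noteq> 0" "t \<noteq> 0"
    using s t assms by (auto simp: min_def split: if_splits)
  then show ?thesis
    using s t by (intro bexI[of _ s] bexI[of _ t]) auto
qed

text \<open>A tripod does not embed in the line: by the pigeonhole principle two of the three
  branches end on the same side of \<open>c\<close>, and negation reduces the falling case to the
  rising one.\<close>

lemma no_three_branches:
  fixes g :: "'i \<Rightarrow> real \<Rightarrow> real"
  assumes "card I = 3" "0 < r" "\<And>i. i \<in> I \<Longrightarrow> continuous_on {0..r} (g i)"
    and "\<And>i. i \<in> I \<Longrightarrow> g i 0 = c" "\<And>i. i \<in> I \<Longrightarrow> g i r \<noteq> c"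
  obtains i j s t where "i \<in> I" "j \<in> I" "i \<noteq> j" "s \<in> {0<..r}" "t \<in> {0<..r}" "g i s = g j t"
proof -
  obtain i j where ij: "i \<in> I" "j \<in> I" "i \<noteq> j" "c < g i r \<longleftrightarrow> c < g j r"
    using assms(1) unfolding card_3_iff by (metis insertCI)
  have "\<exists>s\<in>{0<..r}. \<exists>t\<in>{0<..r}. g i s = g j t"
  proof (cases "c < g i r")
    case True
    then show ?thesis
      using assms(2-4) ij by (intro no_two_rising_branches) auto
  next
    case False
    then have "g i r < c" "g j r < c"
      using ij assms(5) by (metis linorder_neqE_linordered_idom)+
    then have "\<exists>s\<in>{0<..r}. \<exists>t\<in>{0<..r}. - g i s = - g j t"
      using assms(2-4) ij
      by (intro no_two_rising_branches[of r "\<lambda>t. - g i t" "\<lambda>t. - g j t"])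
        (auto intro!: continuous_on_minus)
    then show ?thesis by simp
  qed
  then show thesis
    using that ij by blast
qed

text \<open>The homeomorphism restricts to the complements of \<open>p\<close> and of its image, and
  a circle without a point is a line by stereographic projection.\<close>

lemma homeomorphic_circle_punctured:
  fixes X :: "'a::topological_space set"
  assumes "X homeomorphic sphere (0 :: real ^ 2) 1" "p \<in> X"
  shows "(X - {p}) homeomorphic (UNIV :: real set)"
proof -
  obtain h k where hk: "homeomorphism X (sphere (0 :: real ^ 2) 1) h k"
    using assms(1) unfolding homeomorphic_def by blast
  have hp: "h p \<in> sphere 0 1"
    using hk assms(2) by (auto simp: homeomorphism_def)
  have "h ` (X - {p}) = sphere 0 1 - {h p}"
  proof -
    have "inj_on h X" "h ` X = sphere 0 1"
      using hk unfolding homeomorphism_def inj_on_def by metis+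
    then show ?thesis
      using inj_on_image_set_diff[of h X X "{p}"] assms(2) by auto
  qed
  then have "homeomorphism (X - {p}) (sphere 0 1 - {h p}) h k"
    using hk by (elim homeomorphism_of_subsets) auto
  then have "(X - {p}) homeomorphic (sphere (0 :: real ^ 2) 1 - {h p})"
    unfolding homeomorphic_def by blast
  also have "(sphere (0 :: real ^ 2) 1 - {h p}) homeomorphic (UNIV :: real set)"
    using hp by (intro homeomorphic_punctured_sphere_affine) auto
  finally show ?thesis .
qed

lemma connected_circle_punctured:
  fixes X :: "'a::topological_space set"
  assumes "X homeomorphic sphere (0 :: real ^ 2) 1" "p \<in> X"
  shows "connected (X - {p})"
  using homeomorphic_connectedness[OF homeomorphic_circle_punctured[OF assms]] by simp

text \<open>Three edges at \<open>v\<close> contain a tripod that survives in a suitably punctured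
  circle, that is, in a line. This is excluded by \<open>no_three_branches\<close>.\<close>

lemma circle_degree_le_2:
  assumes "simple_graph H" "realization H homeomorphic sphere (0 :: real ^ 2) 1"
    and "card I = 3" "\<And>w. w \<in> I \<Longrightarrow> {v, w} \<in> snd H"
  shows False
proof -
  obtain x where x: "x \<in> I"
    using assms(3) unfolding card_3_iff by blast
  have ne: "w \<noteq> v" "w \<in> fst H" if "w \<in> I" for w
    using simple_graphD[OF assms(1) assms(4)[OF that]] by auto
  \<comment> \<open>The puncture is the far end of one of the edges. Only the halves of the edges
    near \<open>v\<close> are followed, so that all three avoid it.\<close>
  let ?R = "realization H - {vertex_point x}"
  have "?R homeomorphic (UNIV :: real set)"
    by (intro homeomorphic_circle_punctured vertex_point_in_realization assms ne x)
  then obtain k l where "homeomorphism ?R (UNIV :: real set) k l"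
    unfolding homeomorphic_def by blast
  then have cont: "continuous_on ?R k" and inj: "inj_on k ?R"
    unfolding homeomorphism_def inj_on_def by metis+
  have inR: "edge_point v w t \<in> ?R" if "w \<in> I" "t \<in> {0..1/2}" for w t
  proof -
    \<comment> \<open>The coordinate at \<open>v\<close> is at least 1/2 on these halves, but 0 at
      the puncture.\<close>
    have "edge_point v w t $ v \<noteq> 0"
      using ne(1)[OF that(1)] that(2) by (auto simp: edge_point_component)
    then have "edge_point v w t \<noteq> vertex_point x"
      using ne(1)[OF x] by (auto simp: vertex_point_component)
    then show ?thesis
      using edge_point_in_realization[OF assms(4)[OF that(1)], of t] that(2) by auto
  qed
  have leg: "s = 0 \<and> t = 0 \<or> w = w' \<and> s = t"
    if "edge_point v w s = edge_point v w' t" "w \<in> I" "w' \<in> I" for w w' s t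
  proof -
    \<comment> \<open>The coordinates at the outer ends read off the parameters. On different edges
      each of them vanishes on the other edge, which forces both parameters to be 0.\<close>
    have "edge_point v w s $ w = edge_point v w' t $ w" "edge_point v w s $ w' = edge_point v w' t $ w'"
      using that(1) by simp_all
    then show ?thesis
      using ne(1)[OF that(2)] ne(1)[OF that(3)]
      by (cases "w = w'") (simp_all add: edge_point_component vertex_point_component)
  qed
  have k_leg: "s = 0 \<and> t = 0 \<or> w = w' \<and> s = t"
    if "k (edge_point v w s) = k (edge_point v w' t)" "w \<in> I" "w' \<in> I"
      "s \<in> {0..1/2}" "t \<in> {0..1/2}" for w w' s t
    using inj_onD[OF inj that(1) inR[OF that(2,4)] inR[OF that(3,5)]] that(2,3) by (rule leg)
  have cont_leg: "continuous_on {0..1/2} (\<lambda>t. k (edge_point v w t))" if "w \<in> I" for w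
  proof (rule continuous_on_compose2[OF cont])
    show "continuous_on {0..1/2} (edge_point v w)"
      unfolding edge_point_def by (intro continuous_intros)
    show "edge_point v w ` {0..1/2} \<subseteq> ?R"
      by (rule image_subsetI) (rule inR[OF that])
  qed
  have start: "k (edge_point v w 0) = k (vertex_point v)" for w
    by simp
  have leave: "k (edge_point v w (1/2)) \<noteq> k (vertex_point v)" if "w \<in> I" for w
  proof
    assume "k (edge_point v w (1/2)) = k (vertex_point v)"
    then show False
      using k_leg[of w "1/2" w 0] that by simp
  qed
  obtain i j s t where ij: "i \<in> I" "j \<in> I" "i \<noteq> j" "s \<in> {0<..1/2}" "t \<in> {0<..1/2}"
    "k (edge_point v i s) = k (edge_point v j t)"
    by (rule no_three_branches[OF assms(3) half_gt_zero[OF zero_less_one] cont_leg start leave])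
  then show False
    using k_leg[OF ij(6,1,2)] by simp
qed

text \<open>The coordinate at \<open>v\<close> takes the value \<open>1/2\<close> only at midpoints of edges at \<open>v\<close>. If there is at most
  one of these, puncturing the circle there separates \<open>v\<close> from the part where it vanishes.\<close>

lemma circle_degree_ge_2:
  assumes H: "simple_graph H" "realization H homeomorphic sphere (0 :: real ^ 2) 1"
    and v: "v \<in> fst H"
  obtains w w' where "w \<noteq> w'" "{v, w} \<in> snd H" "{v, w'} \<in> snd H"
proof (rule ccontr)
  note result = that
  assume neg: "\<not> thesis"
  let ?R = "realization H"
  have uniq: "w = w'" if "{v, w} \<in> snd H" "{v, w'} \<in> snd H" for w w'
    using neg result that by blast
  obtain m y where m: "m \<in> ?R" "m \<noteq> vertex_point v" and y: "y \<in> ?R" "y \<noteq> m" "y $ v = 0"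
    and half: "\<And>x. x \<in> ?R \<Longrightarrow> x $ v = 1/2 \<Longrightarrow> x = m"
  proof (cases "\<exists>w. {v, w} \<in> snd H")
    case True
    then obtain w where w: "{v, w} \<in> snd H" by blast
    have wv: "w \<noteq> v" "w \<in> fst H"
      using simple_graphD[OF H(1) w] by auto
    show thesis
    \<comment> \<open>The puncture is the midpoint of the only edge at \<open>v\<close>. The other
      end of this edge serves as the point with vanishing coordinate.\<close>
    proof (rule that[of "edge_point w v (1/2)" "vertex_point w"])
      show "edge_point w v (1/2) \<in> ?R"
        using w by (intro edge_point_in_realization) (auto simp: insert_commute)
      have "edge_point w v (1/2) $ v = 1/2"
        using wv by (auto simp: edge_point_component)
      then show "edge_point w v (1/2) \<noteq> vertex_point v" "vertex_point w \<noteq> edge_point w v (1/2)"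
        using wv by (auto simp: vertex_point_component dest: arg_cong[of _ _ "\<lambda>x. x $ v"])
      show "vertex_point w \<in> ?R" "vertex_point w $ v = 0"
        using wv by (auto simp: vertex_point_component vertex_point_in_realization)
      fix x assume x: "x \<in> ?R" "x $ v = 1/2"
      then have "x \<noteq> vertex_point v"
        by (auto simp: vertex_point_component)
      \<comment> \<open>The edge carrying \<open>x\<close> must be the only one at \<open>v\<close>,
        and the coordinate 1/2 fixes the position on it.\<close>
      then show "x = edge_point w v (1/2)"
        using realization_component_cases[OF H(1) x(1), of v] x(2) uniq[OF w]
        by (metis half_gt_zero_iff less_irrefl zero_less_one)
    qed
  next
    case False
    then have val: "x = vertex_point v \<or> x $ v = 0" if "x \<in> ?R" for x
      using realization_component_cases[OF H(1) that] by blast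
    \<comment> \<open>Without edges at \<open>v\<close> the coordinate is never 1/2, so any puncture
      other than \<open>v\<close> will do. Infinitude of the punctured circle provides both the
      puncture and a further point.\<close>
    have "(?R - {vertex_point v}) homeomorphic (UNIV :: real set)"
      using H(2) v by (intro homeomorphic_circle_punctured vertex_point_in_realization)
    then have "infinite (?R - {vertex_point v})"
      unfolding homeomorphic_def homeomorphism_def
      by (metis finite_imageI infinite_UNIV_char_0)
    then obtain m where m: "m \<in> ?R" "m \<noteq> vertex_point v"
      using infinite_imp_nonempty by blast
    have "infinite (?R - {vertex_point v} - {m})"
      using \<open>infinite (?R - {vertex_point v})\<close> by simp
    then obtain y where "y \<in> ?R" "y \<noteq> vertex_point v" "y \<noteq> m"
      using infinite_imp_nonempty by blast
    then have "y $ v = 0"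
      using val by blast
    moreover have "x = m" if "x \<in> ?R" "x $ v = 1/2" for x
      using val[OF that(1)] that(2) by (auto simp: vertex_point_component)
    ultimately show thesis
      using that m \<open>y \<in> ?R\<close> \<open>y \<noteq> m\<close> by blast
  qed
  have "connected ((\<lambda>x. x $ v) ` (?R - {m}))"
    by (intro connected_continuous_image connected_circle_punctured continuous_intros H m)
  moreover have "0 \<in> (\<lambda>x. x $ v) ` (?R - {m})"
    using y by (intro image_eqI[of _ _ y]) auto
  moreover have "1 \<in> (\<lambda>x. x $ v) ` (?R - {m})"
    using m v vertex_point_in_realization[OF v]
    by (intro image_eqI[of _ _ "vertex_point v"]) (auto simp: vertex_point_component)
  ultimately have "1/2 \<in> (\<lambda>x. x $ v) ` (?R - {m})"
    using connectedD_interval[of _ 0 1 "1/2 :: real"] by simp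
  then show False
    using half by auto
qed

section \<open>Triangles and quadrilaterals are circles\<close>

lemma arc_segment_path:
  assumes "distinct [u, v, w]"
  shows "arc (linepath (vertex_point u) (vertex_point v) +++ linepath (vertex_point v) (vertex_point w))"
proof (rule arc_join)
  show "path_image (linepath (vertex_point u) (vertex_point v)) \<inter>
      path_image (linepath (vertex_point v) (vertex_point w))
    \<subseteq> {pathstart (linepath (vertex_point v) (vertex_point w))}"
    using convex_hull_vertex_points_Int[of "{u, v}" "{v, w}"] assms
    by (simp add: segment_convex_hull Int_insert_left)
qed (use assms in auto)

text \<open>The image of a simple closed path is a circle in the complex plane up to homeomorphism,
  and unit spheres in Euclidean spaces of equal dimension are homeomorphic.\<close>

lemma path_image_homeomorphic_circle:
  fixes g :: "real \<Rightarrow> 'a::t2_space"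
  assumes "simple_path g" "pathfinish g = pathstart g"
  shows "path_image g homeomorphic sphere (0 :: real ^ 2) 1"
proof -
  have "path_image g homeomorphic sphere (0 :: complex) 1"
    using assms by (intro homeomorphic_simple_path_image_circle) auto
  also have "sphere (0 :: complex) 1 homeomorphic sphere (0 :: real ^ 2) 1"
    by (intro homeomorphic_spheres_gen) auto
  finally show ?thesis .
qed

definition triangle_edges :: "'v \<Rightarrow> 'v \<Rightarrow> 'v \<Rightarrow> 'v set set" where
  "triangle_edges a b c = {{a, b}, {b, c}, {a, c}}"

text \<open>The vertices are given in cyclic order, so the diagonals \<open>{a, c}\<close> and
  \<open>{b, d}\<close> are left out. Four vertices therefore carry three quadrilaterals, one for
  each omitted pair of opposite edges.\<close>

definition quadrilateral_edges :: "'v \<Rightarrow> 'v \<Rightarrow> 'v \<Rightarrow> 'v \<Rightarrow> 'v set set" where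
  "quadrilateral_edges a b c d = {{a, b}, {b, c}, {c, d}, {a, d}}"

lemma realization_triangle:
  assumes "distinct [a, b, c]"
  shows "realization ({a, b, c}, triangle_edges a b c) homeomorphic sphere (0 :: real ^ 2) 1"
proof -
  let ?A = "vertex_point a" and ?B = "vertex_point b" and ?C = "vertex_point c"
  let ?g = "linepath ?A ?B +++ linepath ?B ?C" and ?h = "linepath ?C ?A"
  have i: "closed_segment ?A ?B \<inter> closed_segment ?C ?A \<subseteq> {?A}"
    "closed_segment ?B ?C \<inter> closed_segment ?C ?A \<subseteq> {?C}"
    using convex_hull_vertex_points_Int[of "{a, b}" "{c, a}"]
      convex_hull_vertex_points_Int[of "{b, c}" "{c, a}"] assms
    by (auto simp: segment_convex_hull Int_insert_left)
  have "simple_path (?g +++ ?h)"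
    using assms i by (intro simple_path_join_loop arc_segment_path arc_linepath)
      (auto simp: path_image_join)
  then have "path_image (?g +++ ?h) homeomorphic sphere (0 :: real ^ 2) 1"
    by (intro path_image_homeomorphic_circle) auto
  moreover have "path_image (?g +++ ?h) = realization ({a, b, c}, triangle_edges a b c)"
    by (auto simp: path_image_join realization_def triangle_edges_def segment_convex_hull insert_commute hull_inc)
  ultimately show ?thesis by simp
qed

text \<open>The boundary is split at \<open>a\<close> and \<open>c\<close> into two arcs of two
  segments each. Opposite sides are disjoint and adjacent sides share one vertex, so the arcs meet
  only at their ends.\<close>

lemma realization_quadrilateral:
  assumes "distinct [a, b, c, d]"
  shows "realization ({a, b, c, d}, quadrilateral_edges a b c d) homeomorphic sphere (0 :: real ^ 2) 1"
proof -
  let ?A = "vertex_point a" and ?B = "vertex_point b"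
    and ?C = "vertex_point c" and ?D = "vertex_point d"
  let ?g = "linepath ?A ?B +++ linepath ?B ?C" and ?h = "linepath ?C ?D +++ linepath ?D ?A"
  have i: "closed_segment ?A ?B \<inter> closed_segment ?C ?D \<subseteq> {}"
    "closed_segment ?A ?B \<inter> closed_segment ?D ?A \<subseteq> {?A}"
    "closed_segment ?B ?C \<inter> closed_segment ?C ?D \<subseteq> {?C}"
    "closed_segment ?B ?C \<inter> closed_segment ?D ?A \<subseteq> {}"
    using convex_hull_vertex_points_Int[of "{a, b}" "{c, d}"]
      convex_hull_vertex_points_Int[of "{a, b}" "{d, a}"]
      convex_hull_vertex_points_Int[of "{b, c}" "{c, d}"]
      convex_hull_vertex_points_Int[of "{b, c}" "{d, a}"] assms
    by (auto simp: segment_convex_hull Int_insert_left)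
  have "simple_path (?g +++ ?h)"
  proof (rule simple_path_join_loop)
    show "path_image ?g \<inter> path_image ?h \<subseteq> {pathstart ?g, pathstart ?h}"
      using i by (auto simp: path_image_join)
  qed (use assms in \<open>auto intro!: arc_segment_path\<close>)
  then have "path_image (?g +++ ?h) homeomorphic sphere (0 :: real ^ 2) 1"
    by (intro path_image_homeomorphic_circle) auto
  moreover have "path_image (?g +++ ?h) = realization ({a, b, c, d}, quadrilateral_edges a b c d)"
    by (auto simp: path_image_join realization_def quadrilateral_edges_def segment_convex_hull
        insert_commute hull_inc)
  ultimately show ?thesis by simp
qed

section \<open>Classification of the cycles of the complete graph on four vertices\<close>

text \<open>Every vertex of a circle has an edge, by the lower degree bound. Hence a cycle is
  determined by its edge set, and cycles can be counted through their edge sets.\<close>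

lemma cycle_vertices:
  assumes "H \<in> cycles (complete_graph V)"
  shows "fst H = \<Union>(snd H)"
proof
  have H: "simple_graph H" "realization H homeomorphic sphere (0 :: real ^ 2) 1"
    using assms simple_graph_if_cycle_complete unfolding cycles_def by blast+
  show "fst H \<subseteq> \<Union>(snd H)"
    using circle_degree_ge_2[OF H] by blast
  show "\<Union>(snd H) \<subseteq> fst H"
    using H(1) unfolding simple_graph_def by blast
qed

lemma inj_on_snd_cycles: "inj_on snd (cycles (complete_graph V))"
  by (rule inj_onI) (simp add: prod_eq_iff cycle_vertices)

lemma triangle_cycle:
  assumes "distinct [a, b, c]" "{a, b, c} \<subseteq> V"
  shows "({a, b, c}, triangle_edges a b c) \<in> cycles (complete_graph V)"
  unfolding cycles_def using assms realization_triangle[OF assms(1)]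
  by (simp add: subgraph_def complete_graph_def triangle_edges_def)

lemma quadrilateral_cycle:
  assumes "distinct [a, b, c, d]" "{a, b, c, d} \<subseteq> V"
  shows "({a, b, c, d}, quadrilateral_edges a b c d) \<in> cycles (complete_graph V)"
  unfolding cycles_def using assms realization_quadrilateral[OF assms(1)]
  by (simp add: subgraph_def complete_graph_def quadrilateral_edges_def)

text \<open>At each vertex the number of edges of a cycle is neither 1 nor 3, and some edge is
  present. Among the subsets of the six edges this leaves the four triangles and the three
  quadrilaterals, which conversely are circles.\<close>

lemma cycle_edges_K4:
  assumes "distinct [a, b, c, d]"
  shows "snd ` cycles (complete_graph {a, b, c, d}) =
    {triangle_edges a b c, triangle_edges a b d, triangle_edges a c d, triangle_edges b c d,
     quadrilateral_edges a b c d, quadrilateral_edges a b d c, quadrilateral_edges a c b d}"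
    (is "_ = ?C")
proof (intro equalityI subsetI)
  fix E assume "E \<in> snd ` cycles (complete_graph {a, b, c, d})"
  then obtain H where H: "H \<in> cycles (complete_graph {a, b, c, d})" and E: "E = snd H"
    by blast
  note simple = simple_graph_if_cycle_complete[OF H]
  have circle: "realization H homeomorphic sphere (0 :: real ^ 2) 1"
    using H by (simp add: cycles_def)
  have sub: "E \<subseteq> {{a, b}, {a, c}, {a, d}, {b, c}, {b, d}, {c, d}}"
  proof
    fix e assume "e \<in> E"
    then have "e \<subseteq> {a, b, c, d}" "card e = 2"
      using simple E unfolding simple_graph_def by blast+
    then obtain x y where "e = {x, y}" "x \<noteq> y" "x \<in> {a, b, c, d}" "y \<in> {a, b, c, d}"
      unfolding card_2_iff by blast
    then show "e \<in> {{a, b}, {a, c}, {a, d}, {b, c}, {b, d}, {c, d}}"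
      by (elim insertE emptyE) (simp_all add: insert_commute)
  qed
  have ne: "E \<noteq> {}"
  proof
    assume "E = {}"
    then have "realization H = {}"
      using cycle_vertices[OF H] E by (simp add: realization_def)
    then show False
      using circle by simp
  qed
  have le2: "\<not> ({v, x} \<in> E \<and> {v, y} \<in> E \<and> {v, z} \<in> E)" if "distinct [x, y, z]" for v x y z
    using circle_degree_le_2[OF simple(1) circle, of "{x, y, z}" v] that E by auto
  \<comment> \<open>Of the two distinct neighbours that the lower degree bound supplies, at least
    one differs from \<open>w\<close>.\<close>
  have ge2: "\<exists>w'. w' \<noteq> w \<and> {v, w'} \<in> E" if "{v, w} \<in> E" for v w
    using circle_degree_ge_2[OF simple(1) circle, of v] simple_graphD(2)[OF simple(1), of v w] that E
    by metis
  have other: "w' = w \<or> w' = x \<or> w' = y"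
    if "{v, w'} \<in> E" "distinct [v, w, x, y]" "{v, w, x, y} = {a, b, c, d}" for v w x y w'
  proof -
    have "w' \<in> {a, b, c, d}" "w' \<noteq> v"
      using simple_graphD[OF simple(1), of v w'] simple(2) that(1) E by auto
    then show ?thesis
      using that(3) by blast
  qed
  have next_edge: "{v, x} \<in> E \<or> {v, y} \<in> E"
    if "{v, w} \<in> E" "distinct [v, w, x, y]" "{v, w, x, y} = {a, b, c, d}" for v w x y
    using ge2[OF that(1)] other[OF _ that(2,3)] by blast
  \<comment> \<open>Propositional form of the degree condition: the first three conjuncts exclude
    degree 1, the last one degree 3.\<close>
  have degree: "({v, w} \<in> E \<longrightarrow> {v, x} \<in> E \<or> {v, y} \<in> E) \<and>
      ({v, x} \<in> E \<longrightarrow> {v, w} \<in> E \<or> {v, y} \<in> E) \<and>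
      ({v, y} \<in> E \<longrightarrow> {v, w} \<in> E \<or> {v, x} \<in> E) \<and>
      \<not> ({v, w} \<in> E \<and> {v, x} \<in> E \<and> {v, y} \<in> E)"
    if "distinct [v, w, x, y]" "{v, w, x, y} = {a, b, c, d}" for v w x y
  proof (intro conjI impI)
    assume "{v, w} \<in> E"
    then show "{v, x} \<in> E \<or> {v, y} \<in> E"
      using that by (rule next_edge)
  next
    assume "{v, x} \<in> E"
    then show "{v, w} \<in> E \<or> {v, y} \<in> E"
      by (rule next_edge) (use that in auto)
  next
    assume "{v, y} \<in> E"
    then show "{v, w} \<in> E \<or> {v, x} \<in> E"
      by (rule next_edge) (use that in auto)
  next
    show "\<not> ({v, w} \<in> E \<and> {v, x} \<in> E \<and> {v, y} \<in> E)"
      using that(1) by (intro le2) auto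
  qed
  \<comment> \<open>Each edge gets a single spelling, so that the four degree conditions speak about
    the same six atoms.\<close>
  have comm: "{b, a} = {a, b}" "{c, a} = {a, c}" "{d, a} = {a, d}"
    "{c, b} = {b, c}" "{d, b} = {b, d}" "{d, c} = {c, d}"
    by auto
  have deg_a:
    "({a, b} \<in> E \<longrightarrow> {a, c} \<in> E \<or> {a, d} \<in> E) \<and> ({a, c} \<in> E \<longrightarrow> {a, b} \<in> E \<or> {a, d} \<in> E) \<and>
      ({a, d} \<in> E \<longrightarrow> {a, b} \<in> E \<or> {a, c} \<in> E) \<and> \<not> ({a, b} \<in> E \<and> {a, c} \<in> E \<and> {a, d} \<in> E)"
    by (rule degree[of a b c d, unfolded comm]) (use assms in auto)
  have deg_b:
    "({a, b} \<in> E \<longrightarrow> {b, c} \<in> E \<or> {b, d} \<in> E) \<and> ({b, c} \<in> E \<longrightarrow> {a, b} \<in> E \<or> {b, d} \<in> E) \<and>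
      ({b, d} \<in> E \<longrightarrow> {a, b} \<in> E \<or> {b, c} \<in> E) \<and> \<not> ({a, b} \<in> E \<and> {b, c} \<in> E \<and> {b, d} \<in> E)"
    by (rule degree[of b a c d, unfolded comm]) (use assms in auto)
  have deg_c:
    "({a, c} \<in> E \<longrightarrow> {b, c} \<in> E \<or> {c, d} \<in> E) \<and> ({b, c} \<in> E \<longrightarrow> {a, c} \<in> E \<or> {c, d} \<in> E) \<and>
      ({c, d} \<in> E \<longrightarrow> {a, c} \<in> E \<or> {b, c} \<in> E) \<and> \<not> ({a, c} \<in> E \<and> {b, c} \<in> E \<and> {c, d} \<in> E)"
    by (rule degree[of c a b d, unfolded comm]) (use assms in auto)
  have deg_d:
    "({a, d} \<in> E \<longrightarrow> {b, d} \<in> E \<or> {c, d} \<in> E) \<and> ({b, d} \<in> E \<longrightarrow> {a, d} \<in> E \<or> {c, d} \<in> E) \<and>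
      ({c, d} \<in> E \<longrightarrow> {a, d} \<in> E \<or> {b, d} \<in> E) \<and> \<not> ({a, d} \<in> E \<and> {b, d} \<in> E \<and> {c, d} \<in> E)"
    by (rule degree[of d a b c, unfolded comm]) (use assms in auto)
  have "{a, b} \<in> E \<or> {a, c} \<in> E \<or> {a, d} \<in> E \<or> {b, c} \<in> E \<or> {b, d} \<in> E \<or> {c, d} \<in> E"
    using sub ne by blast
  \<comment> \<open>A purely propositional step. Even degree everywhere puts \<open>E\<close> into
    the cycle space, which has dimension 3 over the field with two elements, whence seven nonzero
    cases.\<close>
  then consider
    "{a, b} \<in> E" "{b, c} \<in> E" "{a, c} \<in> E" "{a, d} \<notin> E" "{b, d} \<notin> E" "{c, d} \<notin> E"
    | "{a, b} \<in> E" "{b, d} \<in> E" "{a, d} \<in> E" "{a, c} \<notin> E" "{b, c} \<notin> E" "{c, d} \<notin> E"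
    | "{a, c} \<in> E" "{c, d} \<in> E" "{a, d} \<in> E" "{a, b} \<notin> E" "{b, c} \<notin> E" "{b, d} \<notin> E"
    | "{b, c} \<in> E" "{c, d} \<in> E" "{b, d} \<in> E" "{a, b} \<notin> E" "{a, c} \<notin> E" "{a, d} \<notin> E"
    | "{a, b} \<in> E" "{b, c} \<in> E" "{c, d} \<in> E" "{a, d} \<in> E" "{a, c} \<notin> E" "{b, d} \<notin> E"
    | "{a, b} \<in> E" "{b, d} \<in> E" "{c, d} \<in> E" "{a, c} \<in> E" "{a, d} \<notin> E" "{b, c} \<notin> E"
    | "{a, c} \<in> E" "{b, c} \<in> E" "{b, d} \<in> E" "{a, d} \<in> E" "{a, b} \<notin> E" "{c, d} \<notin> E"
    using deg_a deg_b deg_c deg_d by argo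
  then have "E = triangle_edges a b c \<or> E = triangle_edges a b d \<or> E = triangle_edges a c d \<or>
    E = triangle_edges b c d \<or> E = quadrilateral_edges a b c d \<or>
    E = quadrilateral_edges a b d c \<or> E = quadrilateral_edges a c b d"
  proof cases
    case 1
    then have "E = triangle_edges a b c"
      using sub unfolding triangle_edges_def by blast
    then show ?thesis by simp
  next
    case 2
    then have "E = triangle_edges a b d"
      using sub unfolding triangle_edges_def by blast
    then show ?thesis by simp
  next
    case 3
    then have "E = triangle_edges a c d"
      using sub unfolding triangle_edges_def by blast
    then show ?thesis by simp
  next
    case 4
    then have "E = triangle_edges b c d"
      using sub unfolding triangle_edges_def by blast
    then show ?thesis by simp
  next
    case 5
    then have "E = quadrilateral_edges a b c d"
      using sub unfolding quadrilateral_edges_def by blast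
    then show ?thesis by simp
  next
    case 6
    then have "E = quadrilateral_edges a b d c"
      using sub unfolding quadrilateral_edges_def comm by blast
    then show ?thesis by simp
  next
    case 7
    then have "E = quadrilateral_edges a c b d"
      using sub unfolding quadrilateral_edges_def comm by blast
    then show ?thesis by simp
  qed
  then show "E \<in> ?C" by blast
next
  have tri: "triangle_edges x y z \<in> snd ` cycles (complete_graph {a, b, c, d})"
    if "distinct [x, y, z]" "{x, y, z} \<subseteq> {a, b, c, d}" for x y z
    using triangle_cycle[OF that] by force
  have quad: "quadrilateral_edges x y z w \<in> snd ` cycles (complete_graph {a, b, c, d})"
    if "distinct [x, y, z, w]" "{x, y, z, w} \<subseteq> {a, b, c, d}" for x y z w
    using quadrilateral_cycle[OF that] by force
  fix E assume "E \<in> ?C"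
  then show "E \<in> snd ` cycles (complete_graph {a, b, c, d})"
    by (elim insertE emptyE; hypsubst; intro tri quad) (use assms in auto)
qed

section \<open>Parity of the number of cycles through two edges\<close>

text \<open>The choices of \<open>e'\<close> represent an equal, an adjacent and an opposite edge,
  with counts 4, 2 and 2. Listing the seven cycles without repetition turns the cardinality into the
  length of a filtered list, which can be evaluated.\<close>

lemma even_card_cycle_edges_K4:
  assumes "distinct [a, b, c, d]" "e' \<in> {{a, b}, {a, c}, {c, d}}"
  shows "even (card {E \<in> snd ` cycles (complete_graph {a, b, c, d}). {a, b} \<in> E \<and> e' \<in> E})"
proof -
  let ?C = "[triangle_edges a b c, triangle_edges a b d, triangle_edges a c d, triangle_edges b c d,
     quadrilateral_edges a b c d, quadrilateral_edges a b d c, quadrilateral_edges a c b d]"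
  let ?P = "\<lambda>E. {a, b} \<in> E \<and> e' \<in> E"
  \<comment> \<open>these four edges already tell the seven cycles apart\<close>
  let ?sig = "\<lambda>E. ({a, b} \<in> E, {b, c} \<in> E, {a, c} \<in> E, {a, d} \<in> E)"
  have ne: "a \<noteq> b" "a \<noteq> c" "a \<noteq> d" "b \<noteq> c" "b \<noteq> d" "c \<noteq> d"
    using assms(1) by auto
  have "distinct (map ?sig ?C)"
    by (simp add: triangle_edges_def quadrilateral_edges_def doubleton_eq_iff ne ne[symmetric])
  then have "distinct (filter ?P ?C)"
    using distinct_filter unfolding distinct_map by blast
  moreover have "{E \<in> snd ` cycles (complete_graph {a, b, c, d}). ?P E} = set (filter ?P ?C)"
    unfolding cycle_edges_K4[OF assms(1)] set_filter by simp
  ultimately have "card {E \<in> snd ` cycles (complete_graph {a, b, c, d}). ?P E} = length (filter ?P ?C)"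
    by (simp only: distinct_card)
  moreover have "even (length (filter ?P ?C))"
  proof -
    consider "e' = {a, b}" | "e' = {a, c}" | "e' = {c, d}"
      using assms(2) by blast
    then show ?thesis
      by cases (simp_all add: triangle_edges_def quadrilateral_edges_def doubleton_eq_iff ne ne[symmetric])
  qed
  ultimately show ?thesis by simp
qed

text \<open>By symmetry only the number of common vertices of the two edges matters. The labels are
  chosen so that \<open>e\<close> is \<open>{a, b}\<close> and a single common vertex, if there is
  one, is \<open>a\<close>.\<close>

lemma edge_pair_K4_cases:
  assumes "card V = 4" "e \<in> snd (complete_graph V)" "e' \<in> snd (complete_graph V)"
  obtains a b c d where "distinct [a, b, c, d]" "V = {a, b, c, d}" "e = {a, b}"
    "e' \<in> {{a, b}, {a, c}, {c, d}}"
proof -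
  note result = that
  have fin: "finite V"
    using assms(1) by (metis card.infinite zero_neq_numeral)
  have e: "e \<subseteq> V" "card e = 2" and e': "e' \<subseteq> V" "card e' = 2"
    using assms by (auto simp: complete_graph_def)
  obtain x y where xy: "e = {x, y}" "x \<noteq> y"
    using e by (meson card_2_iff)
  obtain z w where zw: "e' = {z, w}" "z \<noteq> w"
    using e' by (meson card_2_iff)
  have adjacent: thesis if "e = {a, b}" "e' = {a, c}" "a \<noteq> b" "a \<noteq> c" "b \<noteq> c" for a b c
  proof -
    have "card (V - {a, b, c}) = 1"
      using assms(1) fin that e e' by (subst card_Diff_subset) auto
    then obtain d where "V - {a, b, c} = {d}"
      by (meson card_1_singletonE)
    then show thesis
      using that result[of a b c d] e e' by auto
  qed
  have "card (V - e) = 2"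
    using assms(1) fin e by (subst card_Diff_subset) (auto intro: finite_subset)
  then obtain c d where cd: "V - e = {c, d}" "c \<noteq> d"
    by (meson card_2_iff)
  have V: "distinct [x, y, c, d]" "V = {x, y, c, d}"
    using cd xy e by auto
  consider "e' = {x, y}" | "e' = {c, d}"
    | "x \<in> e'" "y \<notin> e'" | "y \<in> e'" "x \<notin> e'"
    using e'(1) zw V by auto
  then show thesis
  proof cases
    case 3
    then show thesis
      \<comment> \<open>The common vertex \<open>x\<close> takes the role of \<open>a\<close>.
        Either of \<open>z\<close> and \<open>w\<close> may be the other end of \<open>e'\<close>,
        hence two instances.\<close>
      using adjacent[of x y z] adjacent[of x y w] xy zw by (auto simp: insert_commute)
  next
    case 4
    then show thesis
      using adjacent[of y x z] adjacent[of y x w] xy zw by (auto simp: insert_commute)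
  qed (use that[OF V xy(1)] in auto)
qed

lemma even_card_cycles_through:
  fixes V :: "'v::finite set"
  assumes "card V = 4" "e \<in> snd (complete_graph V)" "e' \<in> snd (complete_graph V)"
  shows "even (card {H \<in> cycles (complete_graph V). e \<in> snd H \<and> e' \<in> snd H})"
proof -
  let ?S = "{H \<in> cycles (complete_graph V). e \<in> snd H \<and> e' \<in> snd H}"
  obtain a b c d where abcd: "distinct [a, b, c, d]" "V = {a, b, c, d}" "e = {a, b}"
    "e' \<in> {{a, b}, {a, c}, {c, d}}"
    using edge_pair_K4_cases[OF assms] by blast
  have "card ?S = card (snd ` ?S)"
    by (intro card_image [symmetric] inj_on_subset[OF inj_on_snd_cycles]) auto
  also have "snd ` ?S = {E \<in> snd ` cycles (complete_graph V). e \<in> E \<and> e' \<in> E}"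
    by auto
  finally show ?thesis
    using even_card_cycle_edges_K4[OF abcd(1,4)] abcd by simp
qed

section \<open>Double counting of crossings\<close>

text \<open>As \<open>p\<close> has just two preimages in \<open>X\<close>, it remains a multiple
  point on \<open>H\<close> exactly when both lie in the realization of \<open>H\<close>. Both are
  interior to edges, so this is decided by the edges; these may coincide.\<close>

lemma multiple_points_subgraph_iff:
  assumes "simple_graph H" "realization H \<subseteq> X"
    and "{x \<in> X. f x = p} = {edge_point u v s, edge_point u' v' t}"
    and "edge_point u v s \<noteq> edge_point u' v' t" "u \<noteq> v" "u' \<noteq> v'" "s \<in> {0<..<1}" "t \<in> {0<..<1}"
  shows "p \<in> multiple_points f (realization H) \<longleftrightarrow> {u, v} \<in> snd H \<and> {u', v'} \<in> snd H"
proof -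
  let ?x = "edge_point u v s" and ?y = "edge_point u' v' t"
  have pre: "x = ?x \<or> x = ?y" if "x \<in> realization H" "f x = p" for x
    using assms(2,3) that by blast
  have "f ?x = p" "f ?y = p"
    using assms(3) by blast+
  then have "p \<in> multiple_points f (realization H) \<longleftrightarrow> ?x \<in> realization H \<and> ?y \<in> realization H"
    using pre assms(4) unfolding multiple_points_def by blast
  then show ?thesis
    using assms by (simp add: edge_interior_in_realization_iff)
qed

lemma realization_mono: "subgraph H G \<Longrightarrow> realization H \<subseteq> realization G"
  unfolding subgraph_def realization_def by blast

theorem theorem1p1:
  fixes V :: "'v::finite set" and f :: "real ^ 'v \<Rightarrow> real ^ 2"
  assumes "card V = 4"
    and "plane_generic_immersion (complete_graph V) f"
  shows "[(\<Sum>\<gamma>\<in>cycles (complete_graph V). crossing_number_on f \<gamma>) = 0] (mod 2)"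
proof -
  let ?G = "complete_graph V"
  let ?P = "multiple_points f (realization ?G)" and ?M = "\<lambda>H. multiple_points f (realization H)"
  have fin: "finite ?P"
    using assms(2) by (simp add: plane_generic_immersion_def)
  have sub: "realization H \<subseteq> realization ?G" if "H \<in> cycles ?G" for H
    using that by (intro realization_mono) (simp add: cycles_def)
  then have "?M H \<subseteq> ?P" if "H \<in> cycles ?G" for H
    using that unfolding multiple_points_def by blast
  then have "(\<Sum>H\<in>cycles ?G. crossing_number_on f H) = (\<Sum>H\<in>cycles ?G. card {p \<in> ?P. p \<in> ?M H})"
    unfolding crossing_number_on_def by (intro sum.cong arg_cong[of _ _ card]) auto
  \<comment> \<open>Pairs of a cycle and a crossing on it are counted in the other order. The set of
    cycles is finite because \<open>'v\<close> is a finite type.\<close>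
  also have "\<dots> = (\<Sum>p\<in>?P. card {H \<in> cycles ?G. p \<in> ?M H})"
    using sum.swap_restrict[of "cycles ?G" ?P "\<lambda>_ _. 1 :: nat" "\<lambda>H p. p \<in> ?M H"] fin by simp
  finally have sum: "(\<Sum>H\<in>cycles ?G. crossing_number_on f H) =
    (\<Sum>p\<in>?P. card {H \<in> cycles ?G. p \<in> ?M H})" .
  have "even (card {H \<in> cycles ?G. p \<in> ?M H})" if p: "p \<in> ?P" for p
  proof -
    obtain u v u' v' s t where d: "{u, v} \<in> snd ?G" "{u', v'} \<in> snd ?G"
      "s \<in> {0<..<1}" "t \<in> {0<..<1}" "edge_point u v s \<noteq> edge_point u' v' t"
      "{x \<in> realization ?G. f x = p} = {edge_point u v s, edge_point u' v' t}"
      using assms(2) p unfolding plane_generic_immersion_def transversal_double_point_def by blast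
    have "u \<noteq> v" "u' \<noteq> v'"
      using d(1,2) by (auto simp: complete_graph_def)
    \<comment> \<open>The crossing enters only through the edges carrying its two preimages, so the
      count becomes one of cycles through given edges.\<close>
    then have "{H \<in> cycles ?G. p \<in> ?M H} = {H \<in> cycles ?G. {u, v} \<in> snd H \<and> {u', v'} \<in> snd H}"
      using multiple_points_subgraph_iff[OF simple_graph_if_cycle_complete(1) sub d(6,5)] d(3,4)
      by blast
    then show ?thesis
      using even_card_cycles_through[OF assms(1) d(1,2)] by simp
  qed
  then have "even (\<Sum>H\<in>cycles ?G. crossing_number_on f H)"
    unfolding sum by (intro dvd_sum)
  then show ?thesis
    by (simp add: cong_0_iff)
qed

end
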